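(* Let $\mathcal{H}$ be a real Hilbert space, let $f\in\Gamma_0(\mathcal{H})$ be Legendre, let $m\ge1$, and let $\mathcal{S}=\{q_0,q_1,\dots,q_m\}\subseteq\operatorname{int}\operatorname{dom} f$. Then the following hold. (i) $\overleftarrow{E}_f(\mathcal{S})\cap\operatorname{int}\operatorname{dom} f=\nabla f^*\big(\overrightarrow{E}_{f^*}(\nabla f(\mathcal{S}))\big)$. (ii) $\overrightarrow{E}_f(\mathcal{S})=\nabla f^*\big(\overleftarrow{E}_{f^*}(\nabla f(\mathcal{S}))\cap\operatorname{int}\operatorname{dom} f^*\big)$. (iii) $\overleftarrow{CC}^{ps}_f(\mathcal{S})\cap\operatorname{int}\operatorname{dom} f=\nabla f^*\big(\overrightarrow{CC}^{ps}_{f^*}(\nabla f(\mathcal{S}))\big)$. (iv) $\overrightarrow{CC}_f(\mathcal{S})=\operatorname{aff}(\mathcal{S})\cap\nabla f^*\big(\overleftarrow{E}_{f^*}(\nabla f(\mathcal{S}))\cap\operatorname{int}\operatorname{dom} f^*\big)=\nabla f^*\big(\nabla f(\operatorname{aff}(\mathcal{S}))\cap\overleftarrow{E}_{f^*}(\nabla f(\mathcal{S}))\big)$.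
   Context: $\Gamma_0(\mathcal{H})$ is the set of proper closed convex functions $\mathcal{H}\to\,]-\infty,+\infty]$; $f^*$ is the Fenchel conjugate; $\operatorname{aff}$ denotes affine hull. $f\in\Gamma_0(\mathcal{H})$ is Legendre if it is essentially smooth ($\operatorname{dom}\partial f=\operatorname{int}\operatorname{dom} f\neq\varnothing$, $f$ is Gâteaux differentiable on $\operatorname{int}\operatorname{dom} f$, and $\|\nabla f(x_k)\|\to+\infty$ for every sequence $(x_k)$ in $\operatorname{int}\operatorname{dom} f$ converging to a point of $\operatorname{bd}\operatorname{dom} f$) and essentially strictly convex ($(\partial f)^{-1}$ is locally bounded on its domain and $f$ is strictly convex on every convex subset of $\operatorname{dom}\partial f$). If $f$ is Legendre then so is $f^*$, and $\nabla f:\operatorname{int}\operatorname{dom} f\to\operatorname{int}\operatorname{dom} f^*$ is a bijection with inverse $\nabla f^*$. For a Legendre function $g$ and a set $C$, $\nabla g(C)$ means $\{\nabla g(u):u\in C\cap\operatorname{int}\operatorname{dom} g\}$. For a Legendre function $g$ (here $g=f$ or $g=f^*$) the Bregman distance is $D_g(x,y)=g(x)-g(y)-\langle\nabla g(y),x-y\rangle$ if $y\in\operatorname{int}\operatorname{dom} g$, and $+\infty$ otherwise. For a finite nonempty set $K\subseteq\operatorname{int}\operatorname{dom} g$: $\overleftarrow{E}_g(K)=\{x\in\operatorname{dom} g:\ D_g(x,k)\text{ has the same value for all }k\in K\}$; $\overrightarrow{E}_g(K)=\{y\in\operatorname{int}\operatorname{dom} g:\ D_g(k,y)\text{ has the same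 value for all }k\in K\}$; $\overleftarrow{CC}^{ps}_g(K)=\operatorname{aff}(\nabla g(K))\cap\overleftarrow{E}_g(K)$; $\overrightarrow{CC}_g(K)=\operatorname{aff}(K)\cap\overrightarrow{E}_g(K)$; $\overrightarrow{CC}^{ps}_g(K)=\nabla g^*(\operatorname{aff}(K))\cap\overrightarrow{E}_g(K)$ (with $g^*=f$ when $g=f^*$). *)

theory Defs
  imports "HOL-Analysis.Analysis"
begin

section \<open>Convex functions on a real Hilbert space\<close>

definition edom :: "('a \<Rightarrow> ereal) \<Rightarrow> 'a set" where
  "edom f = {x. f x < \<infinity>}"

text \<open>The library's \<^const>\<open>epigraph\<close> is for real-valued functions only.\<close>

definition epi :: "('a \<Rightarrow> ereal) \<Rightarrow> ('a \<times> real) set" where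
  "epi f = {(x, r). f x \<le> ereal r}"

definition Gamma0 :: "('a::real_inner \<Rightarrow> ereal) set" where
  "Gamma0 = {f. (\<forall>x. f x \<noteq> -\<infinity>) \<and> edom f \<noteq> {} \<and> closed (epi f) \<and> convex (epi f)}"

definition conjugate :: "('a::real_inner \<Rightarrow> ereal) \<Rightarrow> 'a \<Rightarrow> ereal" where
  "conjugate f u = (SUP x. ereal (x \<bullet> u) - f x)"

definition subdiff :: "('a::real_inner \<Rightarrow> ereal) \<Rightarrow> 'a \<Rightarrow> 'a set" where
  "subdiff f x = {u. \<forall>y. f x + ereal (u \<bullet> (y - x)) \<le> f y}"

text \<open>Gateaux derivatives are identified with vectors by the Riesz isomorphism.  The difference
  quotient is taken in the extended reals; the limit is two-sided.\<close>

definition has_gateaux_gradient :: "('a::real_inner \<Rightarrow> ereal) \<Rightarrow> 'a \<Rightarrow> 'a \<Rightarrow> bool" where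
  "has_gateaux_gradient f u x \<longleftrightarrow>
     (\<forall>d. ((\<lambda>t. (f (x + t *\<^sub>R d) - f x) / ereal t) \<longlongrightarrow> ereal (u \<bullet> d)) (at 0))"

definition gradient :: "('a::real_inner \<Rightarrow> ereal) \<Rightarrow> 'a \<Rightarrow> 'a" where
  "gradient f x = (THE u. has_gateaux_gradient f u x)"

definition gradient_image :: "('a::real_inner \<Rightarrow> ereal) \<Rightarrow> 'a set \<Rightarrow> 'a set" where
  "gradient_image g C = gradient g ` (C \<inter> interior (edom g))"

section \<open>Legendre functions\<close>

text \<open>The domain of a set-valued operator \<open>A\<close> is the set of points with nonempty value.\<close>

definition op_dom :: "('a \<Rightarrow> 'b set) \<Rightarrow> 'a set" where
  "op_dom A = {x. A x \<noteq> {}}"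

definition op_inverse :: "('a \<Rightarrow> 'b set) \<Rightarrow> 'b \<Rightarrow> 'a set" where
  "op_inverse A u = {x. u \<in> A x}"

definition locally_bounded_at ::
    "('a::topological_space \<Rightarrow> 'b::metric_space set) \<Rightarrow> 'a \<Rightarrow> bool" where
  "locally_bounded_at A x \<longleftrightarrow> (\<exists>U. open U \<and> x \<in> U \<and> bounded (\<Union>y\<in>U. A y))"

definition strictly_convex_on :: "'a::real_vector set \<Rightarrow> ('a \<Rightarrow> ereal) \<Rightarrow> bool" where
  "strictly_convex_on C f \<longleftrightarrow>
     (\<forall>x\<in>C. \<forall>y\<in>C. \<forall>t. x \<noteq> y \<longrightarrow> 0 < t \<longrightarrow> t < 1 \<longrightarrow>
        f ((1 - t) *\<^sub>R x + t *\<^sub>R y) < ereal (1 - t) * f x + ereal t * f y)"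

definition essentially_smooth :: "('a::real_inner \<Rightarrow> ereal) \<Rightarrow> bool" where
  "essentially_smooth f \<longleftrightarrow>
     op_dom (subdiff f) = interior (edom f) \<and>
     interior (edom f) \<noteq> {} \<and>
     (\<forall>x\<in>interior (edom f). \<exists>u. has_gateaux_gradient f u x) \<and>
     (\<forall>X l. (\<forall>k::nat. X k \<in> interior (edom f)) \<longrightarrow> l \<in> frontier (edom f) \<longrightarrow> X \<longlonglongrightarrow> l \<longrightarrow>
        filterlim (\<lambda>k. norm (gradient f (X k))) at_top sequentially)"

definition essentially_strictly_convex :: "('a::real_inner \<Rightarrow> ereal) \<Rightarrow> bool" where
  "essentially_strictly_convex f \<longleftrightarrow>
     (\<forall>u\<in>op_dom (op_inverse (subdiff f)). locally_bounded_at (op_inverse (subdiff f)) u) \<and>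
     (\<forall>C. convex C \<longrightarrow> C \<subseteq> op_dom (subdiff f) \<longrightarrow> strictly_convex_on C f)"

definition legendre :: "('a::real_inner \<Rightarrow> ereal) \<Rightarrow> bool" where
  "legendre f \<longleftrightarrow> essentially_smooth f \<and> essentially_strictly_convex f"

section \<open>Bregman distances, equidistant points and circumcenters\<close>

definition bregman :: "('a::real_inner \<Rightarrow> ereal) \<Rightarrow> 'a \<Rightarrow> 'a \<Rightarrow> ereal" where
  "bregman g x y =
     (if y \<in> interior (edom g) then g x - g y - ereal (gradient g y \<bullet> (x - y)) else \<infinity>)"

text \<open>The suffixes \<open>L\<close> and \<open>R\<close> stand for the left and right arrows over \<open>E\<close> and \<open>CC\<close>.\<close>

definition E_L :: "('a::real_inner \<Rightarrow> ereal) \<Rightarrow> 'a set \<Rightarrow> 'a set" where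
  "E_L g K = {x \<in> edom g. \<forall>k\<in>K. \<forall>k'\<in>K. bregman g x k = bregman g x k'}"

definition E_R :: "('a::real_inner \<Rightarrow> ereal) \<Rightarrow> 'a set \<Rightarrow> 'a set" where
  "E_R g K = {y \<in> interior (edom g). \<forall>k\<in>K. \<forall>k'\<in>K. bregman g k y = bregman g k' y}"

definition CCps_L :: "('a::real_inner \<Rightarrow> ereal) \<Rightarrow> 'a set \<Rightarrow> 'a set" where
  "CCps_L g K = affine hull (gradient_image g K) \<inter> E_L g K"

definition CC_R :: "('a::real_inner \<Rightarrow> ereal) \<Rightarrow> 'a set \<Rightarrow> 'a set" where
  "CC_R g K = affine hull K \<inter> E_R g K"

text \<open>For \<open>g = conjugate f\<close> this uses the gradient of the biconjugate of \<open>f\<close>, which is \<open>f\<close> itself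
  for \<open>f \<in> Gamma0\<close> by the Fenchel--Moreau theorem.\<close>

definition CCps_R :: "('a::real_inner \<Rightarrow> ereal) \<Rightarrow> 'a set \<Rightarrow> 'a set" where
  "CCps_R g K = gradient_image (conjugate g) (affine hull K) \<inter> E_R g K"

end

theory Submission
  imports Defs
begin

text \<open>The gradient of \<open>f\<close> is a bijection between the interiors of the domains of \<open>f\<close> and of its
  conjugate \<open>f\<^sup>*\<close>, its inverse is the gradient of \<open>f\<^sup>*\<close>, and it reverses the arguments of the Bregman
  distances: \<open>D f x y = D f\<^sup>* (\<nabla>f y) (\<nabla>f x)\<close>; the four identities are then set theory.  All the
  convex analysis rests on one compactness principle: a decreasing sequence of nonempty closed
  convex sets, the first of them bounded, has a common point.  It yields minimizers of coercive convex
  functions, hence resolvents of \<open>subdiff f\<close> and the Fenchel--Moreau theorem.  Gateaux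
  differentiability of \<open>f\<^sup>*\<close> follows from it as well: too steep a growth of \<open>f\<^sup>*\<close> at \<open>u\<close> would
  produce a second point at which \<open>u\<close> is a subgradient, against essential strict convexity.\<close>

section \<open>Closed convex sets in Hilbert space\<close>

lemma parallelogram_midpoint:
  fixes a b :: "'a::real_inner"
  shows "(norm (a - b))\<^sup>2 = 2 * (norm a)\<^sup>2 + 2 * (norm b)\<^sup>2 - 4 * (norm ((1/2) *\<^sub>R a + (1/2) *\<^sub>R b))\<^sup>2"
  unfolding power2_norm_eq_inner by (simp add: algebra_simps inner_commute)

text \<open>Points \<open>a n\<close> of almost minimal norm in \<open>A n\<close> form a Cauchy
  sequence. For \<open>n \<le> m\<close> the midpoint of \<open>a n\<close> and \<open>a m\<close>
  still lies in \<open>A n\<close>, so its squared norm is at least \<open>d n\<close>, and the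
  parallelogram identity makes the two points close once \<open>d n\<close> is near its limit.
  Boundedness of \<open>A 0\<close> is what makes the increasing sequence \<open>d\<close>
  converge.\<close>

lemma decseq_closed_convex_Inter_nonempty:
  fixes A :: "nat \<Rightarrow> 'a::{real_inner, complete_space} set"
  assumes ne: "\<And>n. A n \<noteq> {}" and cl: "\<And>n. closed (A n)" and cv: "\<And>n. convex (A n)"
    and dec: "decseq A" and bd: "bounded (A 0)"
  shows "(\<Inter>n. A n) \<noteq> {}"
proof -
  define d where "d n = (INF x\<in>A n. (norm x)\<^sup>2)" for n
  obtain M where M: "\<And>x. x \<in> A 0 \<Longrightarrow> norm x \<le> M"
    using bd by (auto simp: bounded_iff)
  have sub: "A m \<subseteq> A n" if "n \<le> m" for n m
    using dec that by (auto simp: decseq_def)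
  have bb: "bdd_below ((\<lambda>x. (norm x)\<^sup>2) ` A n)" for n
    by (rule bdd_belowI[of _ 0]) auto
  have d_le: "d n \<le> (norm x)\<^sup>2" if "x \<in> A n" for n x
    unfolding d_def by (rule cINF_lower[OF bb that])
  have d_mono: "incseq d"
    unfolding incseq_def d_def
    by (intro allI impI cINF_superset_mono ne bb sub) auto
  have "d n \<le> M\<^sup>2" for n
  proof -
    obtain x where x: "x \<in> A n" using ne by blast
    then have "norm x \<le> M" using M sub[of 0 n] by auto
    then show ?thesis using d_le[OF x] power_mono[of "norm x" M 2] by auto
  qed
  then obtain L where L: "d \<longlonglongrightarrow> L" and dL: "\<And>n. d n \<le> L"
    using incseq_convergent[OF d_mono] by metis
  have "\<exists>x\<in>A n. (norm x)\<^sup>2 < d n + 1 / Suc n" for n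
  proof -
    have "(INF x\<in>A n. (norm x)\<^sup>2) < d n + 1 / Suc n" by (simp add: d_def)
    then show ?thesis using cINF_less_iff[OF ne bb] by blast
  qed
  then obtain a where aA: "\<And>n. a n \<in> A n" and a: "\<And>n. (norm (a n))\<^sup>2 < d n + 1 / Suc n"
    by metis
  have near: "(norm (a n - a m))\<^sup>2 \<le> 2 * (L - d n) + 4 / Suc n" if "n \<le> m" for n m
  proof -
    have "a m \<in> A n" using aA sub[OF that] by blast
    then have "(1/2) *\<^sub>R a n + (1/2) *\<^sub>R a m \<in> A n"
      using aA cv[of n] by (intro convexD) auto
    then have "d n \<le> (norm ((1/2) *\<^sub>R a n + (1/2) *\<^sub>R a m))\<^sup>2" by (rule d_le)
    moreover have "1 / real (Suc m) \<le> 1 / Suc n" using that by (simp add: frac_le)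
    ultimately show ?thesis
      using parallelogram_midpoint[of "a n" "a m"] a[of n] a[of m] dL[of m] unfolding right_diff_distrib
      by linarith
  qed
  have "(\<lambda>n. 2 * (L - d n) + 4 / Suc n) \<longlonglongrightarrow> 2 * (L - L) + 0"
    by (intro tendsto_intros L LIMSEQ_Suc[OF lim_const_over_n])
  then have lim0: "(\<lambda>n. 2 * (L - d n) + 4 / Suc n) \<longlonglongrightarrow> 0" by simp
  have "Cauchy a"
  proof (rule CauchyI')
    fix e :: real assume "0 < e"
    then have "eventually (\<lambda>n. 2 * (L - d n) + 4 / Suc n < e\<^sup>2) sequentially"
      using order_tendstoD(2)[OF lim0, of "e\<^sup>2"] by simp
    then obtain N where N: "\<And>n. n \<ge> N \<Longrightarrow> 2 * (L - d n) + 4 / Suc n < e\<^sup>2"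
      by (auto simp: eventually_sequentially)
    have "dist (a n) (a m) < e" if "n \<ge> N" "n < m" for n m
      unfolding dist_norm using near[of n m] N[of n] that \<open>0 < e\<close>
      by (intro power_less_imp_less_base[of _ 2 e]) auto
    then show "\<exists>N. \<forall>n\<ge>N. \<forall>m>n. dist (a n) (a m) < e" by blast
  qed
  then obtain p where p: "a \<longlonglongrightarrow> p" using Cauchy_convergent convergent_def by blast
  have "p \<in> A n" for n
  proof (rule Lim_in_closed_set[OF cl _ _ p])
    show "eventually (\<lambda>k. a k \<in> A n) sequentially"
      using aA sub by (intro eventually_sequentiallyI[of n]) blast
  qed simp
  then show ?thesis by blast
qed

text \<open>A uniform boundedness principle: by Baire, one of the closed sets \<open>F n\<close>
  contains a ball. One-sided bounds suffice, because the bound in direction \<open>- w0\<close>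
  moves the ball back to the origin.\<close>

lemma pointwise_bounded_above_imp_bounded:
  fixes B :: "'a::{real_inner, complete_space} set"
  assumes "\<And>w. \<exists>c. \<forall>y\<in>B. y \<bullet> w \<le> c"
  shows "bounded B"
proof -
  define F where "F n = {w. \<forall>y\<in>B. y \<bullet> w \<le> real n}" for n
  have cl: "closed (F n)" for n
    unfolding F_def Collect_ball_eq by (intro closed_INT ballI closed_Collect_le continuous_intros)
  have cover: "w \<in> (\<Union>n. F n)" for w
  proof -
    obtain c where "\<forall>y\<in>B. y \<bullet> w \<le> c" using assms by blast
    moreover obtain n where "c \<le> real n" using real_arch_simple by blast
    ultimately show ?thesis by (auto simp: F_def intro: order_trans)
  qed
  have "\<exists>n. interior (F n) \<noteq> {}"
  proof (rule ccontr)
    assume "\<not> ?thesis"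
    then have "euclidean interior_of (\<Union>(range F)) = {}"
      using cl
      by (intro Baire_category_alt) (auto simp: completely_metrizable_space_euclidean interior_of_eq_empty_alt)
    moreover have "(\<Union>n. F n) = UNIV" using cover by blast
    ultimately show False by simp
  qed
  then obtain n w0 where "w0 \<in> interior (F n)" by auto
  then obtain r where r: "r > 0" "cball w0 r \<subseteq> F n"
    by (meson mem_interior_cball)
  obtain c where c: "\<And>y. y \<in> B \<Longrightarrow> y \<bullet> (- w0) \<le> c" using assms by blast
  have "norm y \<le> (real n + c) / r" if y: "y \<in> B" for y
  proof -
    \<comment> \<open>Pairing \<open>y\<close> with this point gives
      \<open>y \<bullet> w0 + r * norm y \<le> n\<close>, and \<open>c\<close> bounds
      \<open>- (y \<bullet> w0)\<close>.\<close>
    have "w0 + r *\<^sub>R sgn y \<in> cball w0 r"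
      using r(1) by (simp add: dist_norm norm_sgn)
    then have "y \<bullet> (w0 + r *\<^sub>R sgn y) \<le> n" using r(2) y by (auto simp: F_def)
    moreover have "y \<bullet> sgn y = norm y" by (cases "y = 0") (simp_all add: sgn_div_norm dot_square_norm power2_eq_square)
    ultimately show ?thesis using c[OF y] r(1) by (simp add: field_simps inner_add_right)
  qed
  then show ?thesis by (auto simp: bounded_iff)
qed

section \<open>Conjugation and subdifferentials\<close>

lemma convex_combination_norm_square:
  fixes x y :: "'a::real_inner"
  shows "(norm ((1 - t) *\<^sub>R x + t *\<^sub>R y))\<^sup>2
    = (1 - t) * (norm x)\<^sup>2 + t * (norm y)\<^sup>2 - t * (1 - t) * (norm (x - y))\<^sup>2"
  unfolding power2_norm_eq_inner by (simp add: algebra_simps inner_commute)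

lemma Gamma0_not_MInf: "f \<in> Gamma0 \<Longrightarrow> f x \<noteq> -\<infinity>"
  by (simp add: Gamma0_def)

lemma Gamma0_convex_ineq:
  assumes "f \<in> Gamma0" "f x \<le> ereal r" "f y \<le> ereal s" "0 \<le> t" "t \<le> 1"
  shows "f ((1 - t) *\<^sub>R x + t *\<^sub>R y) \<le> ereal ((1 - t) * r + t * s)"
proof -
  have "convex (epi f)" using assms(1) by (simp add: Gamma0_def)
  then have "(1 - t) *\<^sub>R (x, r) + t *\<^sub>R (y, s) \<in> epi f"
    using assms by (intro convexD) (auto simp: epi_def)
  then show ?thesis by (simp add: epi_def)
qed

section \<open>Sublevel sets and existence of minimizers\<close>

lemma ereal_add_le_iff: "a + ereal b \<le> ereal c \<longleftrightarrow> a \<le> ereal (c - b)"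
  by (cases a) auto

lemma closed_sublevel:
  fixes q :: "'a::real_inner \<Rightarrow> real"
  assumes "f \<in> Gamma0" "continuous_on UNIV q"
  shows "closed {y. f y + ereal (q y) \<le> ereal c}"
proof -
  have "{y. f y + ereal (q y) \<le> ereal c} = (\<lambda>y. (y, c - q y)) -` epi f"
    by (auto simp: ereal_add_le_iff epi_def)
  moreover have "closed ((\<lambda>y. (y, c - q y)) -` epi f)"
    using assms by (intro closed_vimage continuous_intros) (auto simp: Gamma0_def)
  ultimately show ?thesis by simp
qed

lemma convex_sublevel:
  assumes "f \<in> Gamma0" "convex_on UNIV q"
  shows "convex {y. f y + ereal (q y) \<le> ereal c}"
  unfolding convex_alt
proof (intro ballI allI impI)
  fix x y and t :: real
  assume *: "x \<in> {y. f y + ereal (q y) \<le> ereal c}" "y \<in> {y. f y + ereal (q y) \<le> ereal c}"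
    "0 \<le> t \<and> t \<le> 1"
  have "f ((1 - t) *\<^sub>R x + t *\<^sub>R y) \<le> ereal ((1 - t) * (c - q x) + t * (c - q y))"
    using * by (intro Gamma0_convex_ineq assms(1)) (auto simp: ereal_add_le_iff)
  moreover have "q ((1 - t) *\<^sub>R x + t *\<^sub>R y) \<le> (1 - t) * q x + t * q y"
    using convex_onD[OF assms(2)] * by auto
  ultimately show "(1 - t) *\<^sub>R x + t *\<^sub>R y \<in> {y. f y + ereal (q y) \<le> ereal c}"
    by (auto simp: ereal_add_le_iff algebra_simps intro: order_trans)
qed

text \<open>The sublevel sets at the heights \<open>i + 1 / Suc n\<close> above the infimum
  \<open>i\<close> are nested, closed, convex and bounded; any common point attains the infimum. The
  lower bound \<open>m\<close> and the properness of \<open>f\<close> keep the infimum real.\<close>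

lemma minimizer_exists:
  fixes f :: "'a::{real_inner, complete_space} \<Rightarrow> ereal"
  assumes f: "f \<in> Gamma0" and q: "continuous_on UNIV q" "convex_on UNIV q"
    and below: "\<And>y. ereal m \<le> f y + ereal (q y)"
    and bd: "\<And>c. bounded {y. f y + ereal (q y) \<le> ereal c}"
  obtains p where "\<And>y. f p + ereal (q p) \<le> f y + ereal (q y)"
proof -
  define I where "I = (INF y. f y + ereal (q y))"
  have "ereal m \<le> I" unfolding I_def using below by (intro INF_greatest) auto
  moreover obtain x where "f x < \<infinity>" using f by (auto simp: Gamma0_def edom_def)
  then have "I < \<infinity>" unfolding I_def
    by (intro order.strict_trans1[OF INF_lower[of x]]) (auto simp: less_top[symmetric])
  ultimately obtain i where i: "I = ereal i" by (cases I) auto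
  define A where "A n = {y. f y + ereal (q y) \<le> ereal (i + 1 / Suc n)}" for n
  have "(\<Inter>n. A n) \<noteq> {}"
  proof (rule decseq_closed_convex_Inter_nonempty)
    show "A n \<noteq> {}" for n
    proof -
      have "I < ereal (i + 1 / Suc n)" by (simp add: i)
      then show ?thesis unfolding I_def INF_less_iff A_def by (auto intro: less_imp_le)
    qed
    show "decseq A"
    proof (rule decseq_SucI)
      show "A (Suc n) \<subseteq> A n" for n
      proof
        fix y assume "y \<in> A (Suc n)"
        moreover have "ereal (i + 1 / real (Suc (Suc n))) \<le> ereal (i + 1 / Suc n)"
          by (simp add: frac_le)
        ultimately show "y \<in> A n" unfolding A_def by (blast intro: order_trans)
      qed
    qed
  qed (use bd in \<open>auto simp: A_def intro!: closed_sublevel convex_sublevel f q\<close>)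
  then obtain p where p: "\<And>n. p \<in> A n" by blast
  have "(\<lambda>n. ereal (i + 1 / Suc n)) \<longlonglongrightarrow> ereal (i + 0)"
    by (intro tendsto_intros LIMSEQ_Suc[OF lim_const_over_n])
  then have "f p + ereal (q p) \<le> ereal (i + 0)"
    by (rule LIMSEQ_le_const) (use p in \<open>auto simp: A_def\<close>)
  then have "f p + ereal (q p) \<le> I" by (simp add: i)
  then show ?thesis using that unfolding I_def by (meson INF_lower UNIV_I order_trans)
qed

section \<open>Subgradients and the Fenchel-Young inequality\<close>

lemma subdiff_finite:
  assumes "f \<in> Gamma0" "u \<in> subdiff f x"
  obtains r where "f x = ereal r" "\<And>y. ereal (r + u \<bullet> (y - x)) \<le> f y"
proof -
  obtain y where "f y < \<infinity>" using assms(1) by (auto simp: Gamma0_def edom_def)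
  moreover have "f x + ereal (u \<bullet> (y - x)) \<le> f y" using assms(2) by (simp add: subdiff_def)
  ultimately have "f x \<noteq> \<infinity>" by auto
  then obtain r where r: "f x = ereal r" using Gamma0_not_MInf[OF assms(1), of x] by (cases "f x") auto
  then show ?thesis using that assms(2) by (simp add: subdiff_def)
qed

lemma le_conjugate: "ereal (x \<bullet> u) - f x \<le> conjugate f u"
  unfolding conjugate_def by (rule SUP_upper) simp

lemma Fenchel_Young:
  assumes "f \<in> Gamma0" "conjugate f u \<le> ereal c"
  shows "ereal (x \<bullet> u - c) \<le> f x"
  using le_conjugate[of x u f] assms(2) Gamma0_not_MInf[OF assms(1), of x]
  by (cases "f x"; cases "conjugate f u") auto

lemma conjugate_le_iff:
  assumes "f \<in> Gamma0"
  shows "conjugate f u \<le> ereal c \<longleftrightarrow> (\<forall>x. ereal (x \<bullet> u - c) \<le> f x)"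
proof
  assume "\<forall>x. ereal (x \<bullet> u - c) \<le> f x"
  then have *: "ereal (x \<bullet> u - c) \<le> f x" for x by blast
  have "ereal (x \<bullet> u) - f x \<le> ereal c" for x
    using *[of x] by (cases "f x") auto
  then show "conjugate f u \<le> ereal c"
    unfolding conjugate_def by (intro SUP_least) auto
qed (use Fenchel_Young[OF assms] in auto)

lemma conjugate_eq_subdiff:
  assumes "f \<in> Gamma0" "u \<in> subdiff f x" "f x = ereal r"
  shows "conjugate f u = ereal (x \<bullet> u - r)"
proof (rule antisym)
  show "conjugate f u \<le> ereal (x \<bullet> u - r)"
    using assms by (auto simp: conjugate_le_iff subdiff_def inner_diff_right inner_commute algebra_simps)
qed (use le_conjugate[of x u f] assms in auto)

text \<open>Converse to \<open>conjugate_eq_subdiff\<close>: equality in Fenchel-Young characterizes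
  subgradients. With two inequalities as premises it applies directly to bounds obtained from limits
  or convex combinations.\<close>

lemma subdiffI_conjugate:
  assumes "f \<in> Gamma0" "conjugate f u \<le> ereal c" "f x \<le> ereal (x \<bullet> u - c)"
  shows "u \<in> subdiff f x"
  unfolding subdiff_def
proof (intro CollectI allI)
  fix y
  have "f x + ereal (u \<bullet> (y - x)) \<le> ereal (x \<bullet> u - c) + ereal (u \<bullet> (y - x))"
    by (intro add_right_mono assms)
  also have "\<dots> = ereal (y \<bullet> u - c)" by (simp add: inner_diff_right inner_commute)
  also have "\<dots> \<le> f y" by (rule Fenchel_Young[OF assms(1,2)])
  finally show "f x + ereal (u \<bullet> (y - x)) \<le> f y" .
qed

lemma conjugate_not_MInf:
  assumes "f \<in> Gamma0"
  shows "conjugate f u \<noteq> -\<infinity>"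
proof -
  obtain x where "f x < \<infinity>" using assms by (auto simp: Gamma0_def edom_def)
  then show ?thesis
    using le_conjugate[of x u f] Gamma0_not_MInf[OF assms, of x] by (cases "f x") auto
qed

section \<open>Quadratic regularization and the Fenchel-Moreau theorem\<close>

lemma convex_on_quadratic:
  fixes v :: "'a::real_inner"
  assumes "e \<ge> 0"
  shows "convex_on UNIV (\<lambda>y. e * (norm y)\<^sup>2 - v \<bullet> y)"
proof (rule convex_onI)
  fix t :: real and x y :: 'a
  assume "0 < t" "t < 1"
  then have "0 \<le> e * (t * (1 - t) * (norm (x - y))\<^sup>2)" using assms by simp
  then show "e * (norm ((1 - t) *\<^sub>R x + t *\<^sub>R y))\<^sup>2 - v \<bullet> ((1 - t) *\<^sub>R x + t *\<^sub>R y)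
      \<le> (1 - t) * (e * (norm x)\<^sup>2 - v \<bullet> x) + t * (e * (norm y)\<^sup>2 - v \<bullet> y)"
    unfolding convex_combination_norm_square by (simp add: algebra_simps)
qed simp

text \<open>Fermat's rule, proved without a sum rule for subdifferentials: compare \<open>p\<close>
  with \<open>p + t *\<^sub>R (y - p)\<close>, divide by \<open>t\<close> and let \<open>t\<close>
  tend to 0, which removes the quadratic error. The case \<open>e = 0\<close> is included and serves
  the unregularized problem.\<close>

lemma subdiff_minimizer_quadratic:
  assumes f: "f \<in> Gamma0"
    and min: "\<And>y. f p + ereal (e / 2 * (norm p)\<^sup>2 - v \<bullet> p) \<le> f y + ereal (e / 2 * (norm y)\<^sup>2 - v \<bullet> y)"
  shows "v - e *\<^sub>R p \<in> subdiff f p"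
  unfolding subdiff_def
proof (intro CollectI allI)
  fix y
  show "f p + ereal ((v - e *\<^sub>R p) \<bullet> (y - p)) \<le> f y"
  proof (cases "f y")
    case (real s)
    then have "f p \<noteq> \<infinity>" using min[of y] by auto
    then obtain r where r: "f p = ereal r" using Gamma0_not_MInf[OF f, of p] by (cases "f p") auto
    define h where "h = y - p"
    have key: "(v - e *\<^sub>R p) \<bullet> h - t * (e / 2 * (norm h)\<^sup>2) \<le> s - r" if t: "0 < t" "t < 1" for t
    proof -
      have 1: "f ((1 - t) *\<^sub>R p + t *\<^sub>R y) \<le> ereal ((1 - t) * r + t * s)"
        using t by (intro Gamma0_convex_ineq f) (auto simp: r real)
      have 2: "(1 - t) *\<^sub>R p + t *\<^sub>R y = p + t *\<^sub>R h" by (simp add: h_def algebra_simps)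
      have "f p + ereal (e / 2 * (norm p)\<^sup>2 - v \<bullet> p)
          \<le> ereal ((1 - t) * r + t * s) + ereal (e / 2 * (norm (p + t *\<^sub>R h))\<^sup>2 - v \<bullet> (p + t *\<^sub>R h))"
        by (rule order_trans[OF min add_right_mono[OF 1[unfolded 2]]])
      then have "r + (e / 2 * (norm p)\<^sup>2 - v \<bullet> p)
          \<le> (1 - t) * r + t * s + (e / 2 * (norm (p + t *\<^sub>R h))\<^sup>2 - v \<bullet> (p + t *\<^sub>R h))"
        by (simp add: r)
      then have "t * ((v - e *\<^sub>R p) \<bullet> h - t * (e / 2 * (norm h)\<^sup>2)) \<le> t * (s - r)"
        unfolding power2_norm_eq_inner by (simp add: algebra_simps inner_commute)
      then show ?thesis using t by simp
    qed
    have "((\<lambda>t. (v - e *\<^sub>R p) \<bullet> h - t * (e / 2 * (norm h)\<^sup>2)) \<longlongrightarrow> (v - e *\<^sub>R p) \<bullet> h - 0 * (e / 2 * (norm h)\<^sup>2)) (at_right 0)"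
      by (intro tendsto_intros)
    then have "(v - e *\<^sub>R p) \<bullet> h - 0 * (e / 2 * (norm h)\<^sup>2) \<le> s - r"
      by (rule tendsto_upperbound)
        (use key in \<open>auto simp: eventually_at_right_field intro!: exI[of _ 1]\<close>)
    then show ?thesis by (simp add: r real h_def)
  qed (use Gamma0_not_MInf[OF f] in auto)
qed

text \<open>The existence half of Minty's theorem: \<open>v\<close> lies in the range of
  \<open>subdiff f\<close> plus \<open>e\<close> times the identity. The given subgradient supplies
  an affine minorant, against which the quadratic term makes the objective coercive.\<close>

lemma resolvent_exists:
  fixes f :: "'a::{real_inner, complete_space} \<Rightarrow> ereal"
  assumes f: "f \<in> Gamma0" and "u0 \<in> subdiff f x0" and e: "e > 0"
  obtains p where "v - e *\<^sub>R p \<in> subdiff f p"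
proof -
  obtain r0 where "\<And>y. ereal (r0 + u0 \<bullet> (y - x0)) \<le> f y"
    using subdiff_finite[OF assms(1,2)] by blast
  then have minorant: "ereal ((r0 - u0 \<bullet> x0) + u0 \<bullet> y) \<le> f y" for y by (simp add: inner_diff_right algebra_simps)
  define a where "a = r0 - u0 \<bullet> x0"
  let ?q = "\<lambda>y. e / 2 * (norm y)\<^sup>2 - v \<bullet> y"
  have lower: "ereal (a - norm (v - u0) * norm y + e / 2 * (norm y)\<^sup>2) \<le> f y + ereal (?q y)" for y
  proof -
    have "(v - u0) \<bullet> y \<le> norm (v - u0) * norm y" by (rule norm_cauchy_schwarz)
    then have "a - norm (v - u0) * norm y + e / 2 * (norm y)\<^sup>2 \<le> (a + u0 \<bullet> y) + ?q y"
      by (simp add: inner_diff_left)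
    then have "ereal (a - norm (v - u0) * norm y + e / 2 * (norm y)\<^sup>2) \<le> ereal (a + u0 \<bullet> y) + ereal (?q y)"
      by simp
    also have "\<dots> \<le> f y + ereal (?q y)"
      using minorant by (intro add_right_mono) (simp add: a_def)
    finally show ?thesis .
  qed
  show thesis
  \<comment> \<open>The bound is the minimum over real \<open>s\<close> of
    \<open>a - norm (v - u0) * s + e / 2 * s\<^sup>2\<close>, found by completing the
    square.\<close>
  proof (rule minimizer_exists[OF f, of ?q "a - (norm (v - u0))\<^sup>2 / (2 * e)"])
    show "ereal (a - (norm (v - u0))\<^sup>2 / (2 * e)) \<le> f y + ereal (?q y)" for y
    proof (rule order_trans[OF _ lower])
      have "0 \<le> (norm (v - u0) - e * norm y)\<^sup>2 / (2 * e)" using e by simp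
      also have "\<dots> = (norm (v - u0))\<^sup>2 / (2 * e) - norm (v - u0) * norm y + e / 2 * (norm y)\<^sup>2"
        using e by (simp add: power2_eq_square field_simps)
      finally show "ereal (a - (norm (v - u0))\<^sup>2 / (2 * e))
          \<le> ereal (a - norm (v - u0) * norm y + e / 2 * (norm y)\<^sup>2)" by simp
    qed
    show "bounded {y. f y + ereal (?q y) \<le> ereal c}" for c
      unfolding bounded_iff
    \<comment> \<open>Beyond this radius the quadratic term dominates the linear one. The summand 1
      forces \<open>norm y > 1\<close>, so the constant \<open>\<bar>c - a\<bar>\<close> can be
      absorbed into \<open>\<bar>c - a\<bar> * norm y\<close>.\<close>
    proof (intro exI[of _ "1 + 2 / e * (norm (v - u0) + \<bar>c - a\<bar>)"] ballI, rule ccontr)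
      fix y assume "y \<in> {y. f y + ereal (?q y) \<le> ereal c}"
        and far: "\<not> norm y \<le> 1 + 2 / e * (norm (v - u0) + \<bar>c - a\<bar>)"
      then have *: "a - norm (v - u0) * norm y + e / 2 * (norm y)\<^sup>2 \<le> c"
        using order_trans[OF lower[of y], of "ereal c"] by simp
      have "0 \<le> 2 / e * (norm (v - u0) + \<bar>c - a\<bar>)" using e by simp
      then have y1: "1 < norm y" using far by simp
      have "norm (v - u0) + \<bar>c - a\<bar> < e / 2 * norm y"
      proof -
        have "2 / e * (norm (v - u0) + \<bar>c - a\<bar>) < norm y" using far by simp
        then show ?thesis using e by (simp add: field_simps)
      qed
      then have "(norm (v - u0) + \<bar>c - a\<bar>) * norm y < e / 2 * norm y * norm y"
        using y1 by (intro mult_strict_right_mono) auto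
      moreover have "\<bar>c - a\<bar> \<le> \<bar>c - a\<bar> * norm y" using y1 by (simp add: mult_le_cancel_left1)
      ultimately show False using * by (simp add: algebra_simps power2_eq_square)
    qed
    show "convex_on UNIV ?q" using e by (intro convex_on_quadratic) simp
    fix p assume "\<And>y. f p + ereal (?q p) \<le> f y + ereal (?q y)"
    then show thesis by (intro that subdiff_minimizer_quadratic f)
  qed (intro continuous_intros)
qed

lemma Gamma0_le_limit:
  assumes f: "f \<in> Gamma0" and "X \<longlonglongrightarrow> x" and "\<And>n. f (X n) \<le> ereal c"
  shows "f x \<le> ereal c"
proof -
  have "closed {y. f y + ereal 0 \<le> ereal c}" by (rule closed_sublevel[OF f]) simp
  then show ?thesis using closed_sequentially[of "{y. f y + ereal 0 \<le> ereal c}" X x] assms by simp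
qed

lemma biconjugate_le: "conjugate (conjugate f) x \<le> f x"
  unfolding conjugate_def[of "conjugate f"]
proof (rule SUP_least)
  fix u
  show "ereal (u \<bullet> x) - conjugate f u \<le> f x"
    using le_conjugate[of x u f] by (cases "f x"; cases "conjugate f u") (auto simp: inner_commute)
qed

text \<open>The points \<open>p\<close> with \<open>n *\<^sub>R (x - p) \<in> subdiff f p\<close> are the proximal points of \<open>x\<close>; they
  converge to \<open>x\<close> if the biconjugate is finite at \<open>x\<close>, and \<open>f p\<close> never exceeds that value.\<close>

theorem Fenchel_Moreau:
  fixes f :: "'a::{real_inner, complete_space} \<Rightarrow> ereal"
  assumes f: "f \<in> Gamma0" and u0: "u0 \<in> subdiff f x0"
  shows "conjugate (conjugate f) = f"
proof (rule ext, rule antisym[OF biconjugate_le])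
  fix x
  show "f x \<le> conjugate (conjugate f) x"
  proof (cases "conjugate (conjugate f) x")
    case (real R)
    obtain r0 where "f x0 = ereal r0" and r0: "\<And>y. ereal (r0 + u0 \<bullet> (y - x0)) \<le> f y"
      using subdiff_finite[OF f u0] by blast
    have "\<exists>p. real (Suc n) *\<^sub>R (x - p) \<in> subdiff f p" for n
      using resolvent_exists[OF f u0, of "real (Suc n)" "real (Suc n) *\<^sub>R x"]
      by (auto simp: scaleR_diff_right)
    then obtain p where p: "\<And>n. real (Suc n) *\<^sub>R (x - p n) \<in> subdiff f (p n)" by metis
    have val: "\<exists>r. f (p n) = ereal r \<and> r + Suc n * (norm (x - p n))\<^sup>2 \<le> R
        \<and> r0 + u0 \<bullet> (p n - x0) \<le> r" for n
    proof -
      obtain r where r: "f (p n) = ereal r" using subdiff_finite[OF f p] by blast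
      let ?u = "real (Suc n) *\<^sub>R (x - p n)"
      \<comment> \<open>The subgradient \<open>?u\<close> is a competitor in the supremum defining
        the biconjugate at \<open>x\<close>, and \<open>conjugate f ?u\<close> is known exactly
        because \<open>?u\<close> is a subgradient at \<open>p n\<close>.\<close>
      have "ereal (?u \<bullet> x) - conjugate f ?u \<le> ereal R"
        using le_conjugate[of ?u x "conjugate f"] real by simp
      then have "?u \<bullet> x - (p n \<bullet> ?u - r) \<le> R"
        by (simp add: conjugate_eq_subdiff[OF f p r] del: of_nat_Suc)
      moreover have "?u \<bullet> x - p n \<bullet> ?u = Suc n * (norm (x - p n))\<^sup>2"
        unfolding power2_norm_eq_inner by (simp add: inner_commute algebra_simps)
      ultimately show ?thesis using r r0[of "p n"] by auto
    qed
    define C where "C = R - r0 - u0 \<bullet> (x - x0)"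
    have dist: "norm (x - p n) \<le> (\<bar>C\<bar> + norm u0 + 1) / sqrt (Suc n)" for n
    proof -
      obtain r where r: "r + Suc n * (norm (x - p n))\<^sup>2 \<le> R" "r0 + u0 \<bullet> (p n - x0) \<le> r"
        using val by blast
      define z where "z = norm (x - p n)"
      have "u0 \<bullet> (x - p n) \<le> norm u0 * z" unfolding z_def by (rule norm_cauchy_schwarz)
      then have *: "Suc n * z\<^sup>2 \<le> C + norm u0 * z"
        using r by (simp add: C_def z_def inner_diff_right algebra_simps)
      \<comment> \<open>In terms of \<open>w \<ge> z\<close> the estimate becomes a quadratic
        inequality with coefficients independent of \<open>n\<close>, so \<open>w\<close> is bounded
        and \<open>z\<close> decays like \<open>1 / sqrt (Suc n)\<close>.\<close>
      define w where "w = sqrt (Suc n) * z"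
      have s1: "sqrt (Suc n) \<ge> 1" by simp
      have "z \<ge> 0" by (simp add: z_def)
      then have zw: "z \<le> w" unfolding w_def using s1 mult_right_mono[OF s1, of z] by simp
      have "w\<^sup>2 \<le> C + norm u0 * z" using * by (simp add: w_def power_mult_distrib)
      also have "\<dots> \<le> \<bar>C\<bar> + norm u0 * w" using zw by (intro add_mono mult_left_mono) auto
      finally have w2: "w\<^sup>2 \<le> \<bar>C\<bar> + norm u0 * w" .
      have "w \<le> \<bar>C\<bar> + norm u0 + 1"
      proof (rule ccontr)
        assume far: "\<not> ?thesis"
        then have "w > 1" using norm_ge_zero[of u0] by linarith
        then have "(\<bar>C\<bar> + norm u0) * w < w * w" using far by (intro mult_strict_right_mono) auto
        moreover have "\<bar>C\<bar> \<le> \<bar>C\<bar> * w" using \<open>w > 1\<close> by (simp add: mult_le_cancel_left1)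
        ultimately show False using w2 by (simp add: power2_eq_square algebra_simps)
      qed
      then show ?thesis by (simp add: w_def z_def field_simps)
    qed
    have "(\<lambda>n. (\<bar>C\<bar> + norm u0 + 1) / sqrt (Suc n)) \<longlonglongrightarrow> 0"
      by (rule real_tendsto_divide_at_top[OF tendsto_const])
        (intro filterlim_compose[OF sqrt_at_top] filterlim_compose[OF filterlim_real_sequentially] filterlim_Suc)
    then have "(\<lambda>n. x - p n) \<longlonglongrightarrow> 0"
      by (rule Lim_null_comparison[rotated]) (use dist in auto)
    then have "(\<lambda>n. x - (x - p n)) \<longlonglongrightarrow> x - 0" by (intro tendsto_intros)
    then have "p \<longlonglongrightarrow> x" by simp
    moreover have "f (p n) \<le> ereal R" for n
    proof -
      obtain r where "f (p n) = ereal r" "r + Suc n * (norm (x - p n))\<^sup>2 \<le> R" using val by blast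
      moreover have "0 \<le> Suc n * (norm (x - p n))\<^sup>2" by simp
      ultimately have "r \<le> R" by linarith
      then show ?thesis using \<open>f (p n) = ereal r\<close> by simp
    qed
    ultimately show ?thesis using Gamma0_le_limit[OF f] real by simp
  next
    \<comment> \<open>Impossible: the term of \<open>u0\<close> in the supremum is a real
      number.\<close>
    case MInf
    obtain c where "conjugate f u0 = ereal c"
      using subdiff_finite[OF f u0] conjugate_eq_subdiff[OF f u0] by metis
    then show ?thesis using le_conjugate[of u0 x "conjugate f"] MInf by simp
  qed simp
qed

section \<open>The interior of the conjugate domain\<close>

lemma conjugate_edom_real:
  assumes "f \<in> Gamma0" "u \<in> edom (conjugate f)"
  obtains F where "conjugate f u = ereal F"
  using assms conjugate_not_MInf[OF assms(1), of u] by (cases "conjugate f u") (auto simp: edom_def)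

text \<open>For each direction \<open>w\<close> the conjugate is still finite at
  \<open>u + \<delta> *\<^sub>R w\<close>, so \<open>f\<close> has an affine minorant of that slope.
  On the sublevel set it bounds \<open>y \<bullet> w\<close> from above, and uniform boundedness
  concludes.\<close>

lemma bounded_tilted_sublevel:
  fixes f :: "'a::{real_inner, complete_space} \<Rightarrow> ereal"
  assumes f: "f \<in> Gamma0" and u: "u \<in> interior (edom (conjugate f))"
  shows "bounded {y. f y + ereal (- (u \<bullet> y)) \<le> ereal c}"
proof (rule pointwise_bounded_above_imp_bounded)
  fix w :: 'a
  obtain r where r: "r > 0" "ball u r \<subseteq> edom (conjugate f)"
    using u mem_interior by blast
  define \<delta> where "\<delta> = r / (norm w + 1)"
  have nw: "norm w + 1 > 0" by (smt (verit) norm_ge_zero)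
  have \<delta>: "\<delta> > 0" unfolding \<delta>_def using r(1) nw by simp
  have "\<delta> * norm w < \<delta> * (norm w + 1)" using \<delta> by simp
  also have "\<dots> = r" using nw by (simp add: \<delta>_def)
  finally have "u + \<delta> *\<^sub>R w \<in> ball u r"
    using \<delta> by (simp add: dist_norm)
  then obtain K where "conjugate f (u + \<delta> *\<^sub>R w) = ereal K"
    using r conjugate_edom_real[OF f] by blast
  then have K: "ereal (y \<bullet> (u + \<delta> *\<^sub>R w) - K) \<le> f y" for y
    by (intro Fenchel_Young[OF f]) simp
  have "y \<bullet> w \<le> (c + K) / \<delta>" if "f y + ereal (- (u \<bullet> y)) \<le> ereal c" for y
  proof -
    have "f y \<le> ereal (c + u \<bullet> y)" using that by (simp add: ereal_add_le_iff)
    then have "y \<bullet> (u + \<delta> *\<^sub>R w) - K \<le> c + u \<bullet> y" using order_trans[OF K] ereal_less_eq(3) by blast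
    then show ?thesis using \<delta> by (simp add: inner_add_right inner_commute field_simps)
  qed
  then show "\<exists>c'. \<forall>y\<in>{y. f y + ereal (- (u \<bullet> y)) \<le> ereal c}. y \<bullet> w \<le> c'" by blast
qed

text \<open>Tilting \<open>f\<close> by an interior point \<open>u\<close> makes it coercive, so a
  minimizer exists, and Fermat's rule says that \<open>u\<close> is a subgradient there.\<close>

lemma interior_conjugate_domain_subset_range:
  fixes f :: "'a::{real_inner, complete_space} \<Rightarrow> ereal"
  assumes f: "f \<in> Gamma0" and u: "u \<in> interior (edom (conjugate f))"
  obtains x where "u \<in> subdiff f x"
proof -
  obtain F where F: "conjugate f u = ereal F"
    using conjugate_edom_real[OF f] u interior_subset by blast
  \<comment> \<open>The vanishing quadratic term keeps the shape expected by
    \<open>subdiff_minimizer_quadratic\<close> with \<open>e = 0\<close>.\<close>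
  let ?q = "\<lambda>y. 0 / 2 * (norm y)\<^sup>2 - u \<bullet> y"
  show thesis
  proof (rule minimizer_exists[OF f, of ?q "- F"])
    show "ereal (- F) \<le> f y + ereal (?q y)" for y
      using Fenchel_Young[OF f, of u F y] F by (cases "f y") (auto simp: inner_commute)
    show "convex_on UNIV ?q" by (rule convex_on_quadratic) simp
    show "bounded {y. f y + ereal (?q y) \<le> ereal c}" for c
      using bounded_tilted_sublevel[OF f u] by simp
    fix p assume "\<And>y. f p + ereal (?q p) \<le> f y + ereal (?q y)"
    then have "u - 0 *\<^sub>R p \<in> subdiff f p" by (intro subdiff_minimizer_quadratic f)
    then show thesis using that by simp
  qed (intro continuous_intros)
qed

lemma subdiff_monotone:
  assumes "f \<in> Gamma0" "u \<in> subdiff f x" "v \<in> subdiff f y"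
  shows "0 \<le> (u - v) \<bullet> (x - y)"
proof -
  obtain r where r: "f x = ereal r" "\<And>z. ereal (r + u \<bullet> (z - x)) \<le> f z"
    using subdiff_finite[OF assms(1,2)] by blast
  obtain s where s: "f y = ereal s" "\<And>z. ereal (s + v \<bullet> (z - y)) \<le> f z"
    using subdiff_finite[OF assms(1,3)] by blast
  show ?thesis using r(2)[of y] s(2)[of x] r(1) s(1)
    by (simp add: inner_diff_left inner_diff_right)
qed

text \<open>For \<open>v\<close> near \<open>u\<close> the regularised problems \<open>v - e *\<^sub>R p \<in> subdiff f p\<close> have, by monotonicity,
  subgradients near \<open>u\<close>, so local boundedness controls \<open>p\<close> uniformly as \<open>e\<close> tends to \<open>0\<close>.\<close>

lemma subgradient_in_interior_conjugate_domain:
  fixes f :: "'a::{real_inner, complete_space} \<Rightarrow> ereal"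
  assumes f: "f \<in> Gamma0" and u: "u \<in> subdiff f x"
    and lb: "locally_bounded_at (op_inverse (subdiff f)) u"
  shows "u \<in> interior (edom (conjugate f))"
proof -
  obtain U where "open U" "u \<in> U" and bU: "bounded (\<Union>w\<in>U. op_inverse (subdiff f) w)"
    using lb by (auto simp: locally_bounded_at_def)
  then obtain \<delta> where \<delta>: "\<delta> > 0" "ball u \<delta> \<subseteq> U" by (meson openE)
  obtain M where M0: "\<And>p. p \<in> (\<Union>w\<in>U. op_inverse (subdiff f) w) \<Longrightarrow> norm p \<le> M"
    using bU by (auto simp: bounded_iff)
  have M: "norm p \<le> M" if "w \<in> ball u \<delta>" "w \<in> subdiff f p" for w p
    using that \<delta> by (intro M0) (auto simp: op_inverse_def)
  obtain r where r: "\<And>z. ereal (r + u \<bullet> (z - x)) \<le> f z"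
    using subdiff_finite[OF f u] by blast
  have "v \<in> edom (conjugate f)" if v: "v \<in> ball u (\<delta> / 4)" for v
  proof -
    \<comment> \<open>\<open>B\<close> bounds \<open>p \<bullet> w - f p\<close>, which is
      \<open>conjugate f w\<close>, using \<open>norm p \<le> M\<close>,
      \<open>norm w \<le> norm u + \<delta>\<close> and the affine minorant of slope
      \<open>u\<close>. The choice of \<open>e0\<close> gives
      \<open>e * norm x \<le> \<delta> / 8\<close>, so that twice
      \<open>norm (v - u) + e * norm x\<close> stays below \<open>\<delta>\<close>.\<close>
    define B where "B = M * (norm u + \<delta>) + M * norm u + norm u * norm x - r"
    define e0 where "e0 = \<delta> / (8 * (norm x + 1))"
    have nx: "norm x + 1 > 0" by (smt (verit) norm_ge_zero)
    have e0: "e0 > 0" using \<delta>(1) nx by (simp add: e0_def)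
    have vu: "norm (v - u) < \<delta> / 4" using v by (simp add: dist_norm norm_minus_commute)
    have approx: "\<exists>w. norm (w - v) \<le> e * M \<and> conjugate f w \<le> ereal B" if e: "0 < e" "e \<le> e0" for e
    proof -
      obtain p where p: "v - e *\<^sub>R p \<in> subdiff f p" using resolvent_exists[OF f u e(1)] by blast
      define w where "w = v - e *\<^sub>R p"
      have w: "w \<in> subdiff f p" using p by (simp add: w_def)
      have ex: "e * norm x \<le> \<delta> / 8"
      proof -
        have "e * norm x \<le> e0 * (norm x + 1)" using e e0 by (intro mult_mono) auto
        also have "\<dots> = \<delta> / 8" using nx by (simp add: e0_def divide_simps)
        finally show ?thesis .
      qed
      \<comment> \<open>Here \<open>w - u\<close> is \<open>v - u - e *\<^sub>R x\<close> minus
        \<open>e *\<^sub>R (p - x)\<close>, so monotonicity controls \<open>e * norm (p - x)\<close>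
        before any bound on \<open>p\<close> is available. Only then is \<open>w\<close> known to
        lie in the ball where \<open>M\<close> applies.\<close>
      have "0 \<le> (w - u) \<bullet> (p - x)" by (rule subdiff_monotone[OF f w u])
      then have "e * (norm (p - x))\<^sup>2 \<le> (v - u - e *\<^sub>R x) \<bullet> (p - x)"
        unfolding power2_norm_eq_inner w_def by (simp add: algebra_simps inner_commute)
      also have "\<dots> \<le> norm (v - u - e *\<^sub>R x) * norm (p - x)" by (rule norm_cauchy_schwarz)
      finally have "(e * norm (p - x)) * norm (p - x) \<le> norm (v - u - e *\<^sub>R x) * norm (p - x)"
        by (simp add: power2_eq_square mult.assoc)
      then have "e * norm (p - x) \<le> norm (v - u - e *\<^sub>R x)"
        by (cases "p = x") auto
      also have "\<dots> \<le> norm (v - u) + e * norm x"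
        using norm_triangle_ineq4[of "v - u" "e *\<^sub>R x"] e by simp
      finally have 1: "e * norm (p - x) \<le> norm (v - u) + e * norm x" .
      have "norm (w - u) \<le> norm (v - u) + e * norm (p - x) + e * norm x"
      proof -
        have "w - u = (v - u) - e *\<^sub>R (p - x) - e *\<^sub>R x" by (simp add: w_def algebra_simps)
        then have "norm (w - u) \<le> norm (v - u) + norm (e *\<^sub>R (p - x)) + norm (e *\<^sub>R x)"
          by (metis (no_types, lifting) add_mono_thms_linordered_semiring(3) norm_triangle_ineq4 order_trans)
        then show ?thesis using e by simp
      qed
      then have "norm (w - u) < \<delta>" using 1 vu ex \<delta>(1) by linarith
      then have wb: "w \<in> ball u \<delta>" by (simp add: dist_norm norm_minus_commute)
      have pM: "norm p \<le> M" by (rule M[OF wb w])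
      obtain s where s: "f p = ereal s" using subdiff_finite[OF f w] by blast
      have "norm w \<le> norm u + \<delta>"
        using \<open>norm (w - u) < \<delta>\<close> norm_triangle_ineq2[of w u] by linarith
      moreover have "p \<bullet> w \<le> norm p * norm w" by (rule norm_cauchy_schwarz)
      moreover have "norm p * norm w \<le> M * (norm u + \<delta>)"
        using pM calculation(1) norm_ge_zero[of p] norm_ge_zero[of w] by (intro mult_mono) linarith+
      moreover have "- (u \<bullet> p) \<le> M * norm u"
      proof -
        have "- (u \<bullet> p) \<le> norm p * norm u"
          using norm_cauchy_schwarz[of "- p" u] by (simp add: inner_commute)
        also have "\<dots> \<le> M * norm u" using pM by (intro mult_right_mono) auto
        finally show ?thesis .
      qed
      moreover have "r + u \<bullet> p - u \<bullet> x \<le> s" using r[of p] s by (simp add: inner_diff_right)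
      moreover have "u \<bullet> x \<le> norm u * norm x" by (rule norm_cauchy_schwarz)
      ultimately have "p \<bullet> w - s \<le> B" unfolding B_def by linarith
      then have "conjugate f w \<le> ereal B" by (simp add: conjugate_eq_subdiff[OF f w s])
      moreover have "norm (w - v) \<le> e * M" using e pM by (simp add: w_def)
      ultimately show ?thesis by blast
    qed
    \<comment> \<open>Lower semicontinuity of the conjugate, written out: each affine minorant of
      slope \<open>w\<close> passes to slope \<open>v\<close> with an error of at most
      \<open>e * (norm z * M)\<close>.\<close>
    have "conjugate f v \<le> ereal B"
      unfolding conjugate_le_iff[OF f]
    proof
      fix z
      show "ereal (z \<bullet> v - B) \<le> f z"
      proof (cases "f z")
        case (real s)
        have "z \<bullet> v - e * (norm z * M) - B \<le> s" if "0 < e" "e < e0" for e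
        proof -
          obtain w where w: "norm (w - v) \<le> e * M" "conjugate f w \<le> ereal B"
            using approx[of e] \<open>0 < e\<close> \<open>e < e0\<close> by auto
          have "z \<bullet> w - B \<le> s" using Fenchel_Young[OF f w(2), of z] real by simp
          moreover have "z \<bullet> (v - w) \<le> norm z * norm (v - w)" by (rule norm_cauchy_schwarz)
          moreover have "norm z * norm (v - w) \<le> norm z * (e * M)"
            using w(1) by (intro mult_left_mono) (auto simp: norm_minus_commute)
          ultimately show ?thesis by (simp add: inner_diff_right algebra_simps)
        qed
        moreover have "((\<lambda>e. z \<bullet> v - e * (norm z * M) - B) \<longlongrightarrow> z \<bullet> v - 0 * (norm z * M) - B) (at_right 0)"
          by (intro tendsto_intros)
        ultimately have "z \<bullet> v - 0 * (norm z * M) - B \<le> s"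
          using e0 by (intro tendsto_upperbound) (auto simp: eventually_at_right_field intro!: exI[of _ e0])
        then show ?thesis using real by simp
      qed (use Gamma0_not_MInf[OF f] in auto)
    qed
    then show ?thesis by (auto simp: edom_def)
  qed
  then show ?thesis using \<delta>(1) by (intro interiorI[of "ball u (\<delta> / 4)"]) auto
qed

section \<open>Gateaux gradients and Legendre functions\<close>

lemma has_gateaux_gradient_unique:
  assumes "has_gateaux_gradient f u x" "has_gateaux_gradient f v x"
  shows "u = v"
proof -
  have "ereal (u \<bullet> d) = ereal (v \<bullet> d)" for d
    using tendsto_unique[OF at_neq_bot, of _ "ereal (u \<bullet> d)" 0 "ereal (v \<bullet> d)"] assms
    unfolding has_gateaux_gradient_def by fast
  then show ?thesis using vector_eq_rdot[of u v] by simp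
qed

lemma gradient_eqI: "has_gateaux_gradient f u x \<Longrightarrow> gradient f x = u"
  unfolding gradient_def by (intro the_equality has_gateaux_gradient_unique)

text \<open>Right-hand difference quotients dominate \<open>v \<bullet> d\<close>; applying this to
  \<open>- d\<close> as well gives equality in every direction.\<close>

lemma subgradient_eq_gateaux_gradient:
  assumes f: "f \<in> Gamma0" and v: "v \<in> subdiff f x" and u: "has_gateaux_gradient f u x"
  shows "v = u"
proof -
  obtain r where r: "f x = ereal r" "\<And>y. ereal (r + v \<bullet> (y - x)) \<le> f y"
    using subdiff_finite[OF f v] by blast
  have le: "v \<bullet> d \<le> u \<bullet> d" for d
  proof -
    have "((\<lambda>t. (f (x + t *\<^sub>R d) - f x) / ereal t) \<longlongrightarrow> ereal (u \<bullet> d)) (at_right 0)"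
      using u by (auto simp: has_gateaux_gradient_def intro: tendsto_mono[OF at_le])
    moreover have "ereal (v \<bullet> d) \<le> (f (x + t *\<^sub>R d) - f x) / ereal t" if "t > 0" for t
      using that r(1) r(2)[of "x + t *\<^sub>R d"] by (cases "f (x + t *\<^sub>R d)") (auto simp: field_simps)
    ultimately have "ereal (v \<bullet> d) \<le> ereal (u \<bullet> d)"
      by (intro tendsto_lowerbound) (auto simp: eventually_at_right_field intro!: exI[of _ 1])
    then show ?thesis by simp
  qed
  have "v \<bullet> d = u \<bullet> d" for d using le[of d] le[of "- d"] by simp
  then show ?thesis using vector_eq_rdot[of v u] by simp
qed

text \<open>If the bound fails for arbitrarily small \<open>t\<close>, the points \<open>p\<close>
  having \<open>u + t *\<^sub>R d\<close> as subgradient satisfy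
  \<open>x \<bullet> d + e \<le> d \<bullet> p\<close>, stay in a fixed ball and nearly minimize
  \<open>f\<close> tilted by \<open>u\<close>. The nested sets \<open>A n\<close> collect such
  points. A common point is an exact minimizer, hence equals \<open>x\<close>, which violates the
  steepness condition.\<close>

lemma conjugate_upper_directional_bound:
  fixes f :: "'a::{real_inner, complete_space} \<Rightarrow> ereal"
  assumes f: "f \<in> Gamma0" and int: "u \<in> interior (edom (conjugate f))"
    and ux: "u \<in> subdiff f x" and uniq: "\<And>y. u \<in> subdiff f y \<Longrightarrow> y = x"
    and lb: "locally_bounded_at (op_inverse (subdiff f)) u"
    and F: "conjugate f u = ereal F" and e: "e > 0"
  shows "\<exists>\<tau>>0. \<forall>t. 0 < t \<and> t < \<tau> \<longrightarrow> conjugate f (u + t *\<^sub>R d) \<le> ereal (F + t * (x \<bullet> d + e))"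
proof (rule ccontr)
  assume "\<not> ?thesis"
  then have contr: "\<exists>t. 0 < t \<and> t < \<tau> \<and> ereal (F + t * (x \<bullet> d + e)) < conjugate f (u + t *\<^sub>R d)"
    if "\<tau> > 0" for \<tau> using that by (auto simp: not_le)
  obtain U where U: "open U" "u \<in> U" and bU: "bounded (\<Union>w\<in>U. op_inverse (subdiff f) w)"
    using lb by (auto simp: locally_bounded_at_def)
  have "open (U \<inter> interior (edom (conjugate f)))" using U by (intro open_Int) auto
  then obtain \<rho> where \<rho>: "\<rho> > 0" "ball u \<rho> \<subseteq> U \<inter> interior (edom (conjugate f))"
    using U int by (meson IntI openE)
  obtain M where M0: "\<And>p. p \<in> (\<Union>w\<in>U. op_inverse (subdiff f) w) \<Longrightarrow> norm p \<le> M"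
    using bU by (auto simp: bounded_iff)
  have M: "norm p \<le> M" if "w \<in> ball u \<rho>" "w \<in> subdiff f p" for w p
    using that \<rho> by (intro M0) (auto simp: op_inverse_def)
  \<comment> \<open>This bounds \<open>p \<bullet> d - x \<bullet> d\<close> for all
    \<open>p\<close> of norm at most \<open>M\<close>; the summand 1 makes it positive, so that one
    can divide by it.\<close>
  define c where "c = (M + norm x) * norm d + 1"
  have "norm x \<le> M" using M[OF _ ux] \<rho> by simp
  then have c: "c > 0" unfolding c_def using norm_ge_zero[of x] by (smt (verit) mult_nonneg_nonneg norm_ge_zero)
  have nd: "norm d + 1 > 0" by (smt (verit) norm_ge_zero)
  define q where "q y = 0 / 2 * (norm y)\<^sup>2 - u \<bullet> y" for y
  define A where "A n = {y. f y + ereal (q y) \<le> ereal (1 / Suc n - F)}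
    \<inter> ({y. x \<bullet> d + e \<le> d \<bullet> y} \<inter> cball 0 M)" for n
  obtain r where r: "f x = ereal r" using subdiff_finite[OF f ux] by blast
  have Fr: "F = x \<bullet> u - r" using conjugate_eq_subdiff[OF f ux r] F by simp
  have "(\<Inter>n. A n) \<noteq> {}"
  proof (rule decseq_closed_convex_Inter_nonempty)
    show "A n \<noteq> {}" for n
    proof -
      \<comment> \<open>The first bound on \<open>t\<close> keeps \<open>u + t *\<^sub>R d\<close>
        in the ball where subgradients are controlled; the second makes the excess
        \<open>t * c\<close> over the minimal value \<open>- F\<close> at most
        \<open>1 / Suc n\<close>.\<close>
      have "min (\<rho> / (norm d + 1)) (1 / (Suc n * c)) > 0"
        using \<rho> nd c by (auto intro!: divide_pos_pos simp del: of_nat_Suc)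
      from contr[OF this] obtain t where t: "0 < t" "t < \<rho> / (norm d + 1)" "t < 1 / (Suc n * c)"
        and big: "ereal (F + t * (x \<bullet> d + e)) < conjugate f (u + t *\<^sub>R d)" by auto
      have "t * norm d \<le> t * (norm d + 1)" using t by simp
      also have "\<dots> < \<rho>" using t(2) nd by (simp add: field_simps)
      finally have ball: "u + t *\<^sub>R d \<in> ball u \<rho>" using t by (simp add: dist_norm)
      then obtain p where p: "u + t *\<^sub>R d \<in> subdiff f p"
        using interior_conjugate_domain_subset_range[OF f] \<rho>(2) by blast
      have pM: "norm p \<le> M" by (rule M[OF ball p])
      obtain s where s: "f p = ereal s" using subdiff_finite[OF f p] by blast
      have cp: "conjugate f (u + t *\<^sub>R d) = ereal (p \<bullet> (u + t *\<^sub>R d) - s)"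
        by (rule conjugate_eq_subdiff[OF f p s])
      have "p \<bullet> u - s \<le> F" using le_conjugate[of p u f] s F by simp
      moreover have "F + t * (x \<bullet> d + e) < p \<bullet> u + t * (p \<bullet> d) - s"
        using big cp by (simp add: inner_add_right)
      ultimately have "t * (x \<bullet> d + e) < t * (p \<bullet> d)" by linarith
      then have steep: "x \<bullet> d + e \<le> d \<bullet> p" using t by (simp add: inner_commute)
      have "x \<bullet> (u + t *\<^sub>R d) - r \<le> p \<bullet> (u + t *\<^sub>R d) - s"
        using le_conjugate[of x "u + t *\<^sub>R d" f] cp r by simp
      then have "s - u \<bullet> p + F \<le> t * (p \<bullet> d - x \<bullet> d)"
        by (simp add: Fr inner_add_right inner_commute algebra_simps)
      also have "\<dots> \<le> t * c"
      proof -
        have "p \<bullet> d \<le> norm p * norm d" "- x \<bullet> d \<le> norm (- x) * norm d" by (rule norm_cauchy_schwarz)+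
        moreover have "norm p * norm d \<le> M * norm d" using pM by (intro mult_right_mono) auto
        ultimately have "p \<bullet> d - x \<bullet> d \<le> c" by (simp add: c_def algebra_simps)
        then show ?thesis using t by simp
      qed
      also have "\<dots> \<le> 1 / Suc n" using t(3) c by (simp add: field_simps del: of_nat_Suc)
      finally have "f p + ereal (q p) \<le> ereal (1 / Suc n - F)" by (simp add: s q_def algebra_simps)
      then have "p \<in> A n" using steep pM by (simp add: A_def)
      then show ?thesis by blast
    qed
    show "closed (A n)" for n
      unfolding A_def
      by (intro closed_Int closed_sublevel f closed_halfspace_ge closed_cball)
        (unfold q_def, intro continuous_intros)
    show "convex (A n)" for n
      unfolding A_def
      by (intro convex_Int convex_sublevel f convex_halfspace_ge convex_cball)
        (unfold q_def, rule convex_on_quadratic, simp)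
    show "decseq A"
    proof (rule decseq_SucI)
      show "A (Suc n) \<subseteq> A n" for n
      proof -
        have "ereal (1 / Suc (Suc n) - F) \<le> ereal (1 / Suc n - F)" by (simp add: frac_le)
        then show ?thesis unfolding A_def by (blast intro: order_trans)
      qed
    qed
    show "bounded (A 0)" unfolding A_def by (intro bounded_Int) auto
  qed
  then obtain p where p: "\<And>n. p \<in> A n" by blast
  have "(\<lambda>n. ereal (1 / Suc n - F)) \<longlonglongrightarrow> ereal (0 - F)"
    by (intro tendsto_intros LIMSEQ_Suc[OF lim_const_over_n])
  then have "f p + ereal (q p) \<le> ereal (0 - F)"
    by (rule LIMSEQ_le_const) (use p in \<open>auto simp: A_def simp del: of_nat_Suc\<close>)
  then have "f p \<le> ereal (p \<bullet> u - F)"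
    by (simp add: ereal_add_le_iff q_def inner_commute algebra_simps)
  then have "p = x" using F by (intro uniq subdiffI_conjugate[OF f, of _ F]) auto
  then show False using p[of 0] e by (simp add: A_def inner_commute)
qed

text \<open>The difference quotient is squeezed: the lower bound comes from \<open>x\<close> as a
  competitor in the supremum, and the upper bound for directions \<open>d\<close> and
  \<open>- d\<close> covers positive and negative \<open>t\<close>.\<close>

lemma conjugate_has_gateaux_gradient:
  fixes f :: "'a::{real_inner, complete_space} \<Rightarrow> ereal"
  assumes f: "f \<in> Gamma0" and int: "u \<in> interior (edom (conjugate f))"
    and ux: "u \<in> subdiff f x" and uniq: "\<And>y. u \<in> subdiff f y \<Longrightarrow> y = x"
    and lb: "locally_bounded_at (op_inverse (subdiff f)) u"
  shows "has_gateaux_gradient (conjugate f) x u"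
  unfolding has_gateaux_gradient_def
proof
  fix d
  obtain r where r: "f x = ereal r" using subdiff_finite[OF f ux] by blast
  define F where "F = x \<bullet> u - r"
  have F: "conjugate f u = ereal F" unfolding F_def by (rule conjugate_eq_subdiff[OF f ux r])
  have lower: "ereal (F + t * (x \<bullet> d)) \<le> conjugate f (u + t *\<^sub>R d)" for t
    using le_conjugate[of x "u + t *\<^sub>R d" f] r by (simp add: F_def inner_add_right algebra_simps)
  have upper: "\<exists>\<tau>>0. \<forall>t. 0 < t \<and> t < \<tau> \<longrightarrow> conjugate f (u + t *\<^sub>R d') \<le> ereal (F + t * (x \<bullet> d' + e))"
    if "e > 0" for e d'
    by (rule conjugate_upper_directional_bound[OF f int ux uniq lb F that])
  \<comment> \<open>Near 0 the conjugate is finite along the line, so \<open>\<phi>\<close>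
    represents it there; the default value of \<open>real_of_ereal\<close> at infinity cannot affect
    the limit.\<close>
  define \<phi> where "\<phi> t = real_of_ereal (conjugate f (u + t *\<^sub>R d))" for t
  have bound: "\<exists>\<tau>>0. \<forall>t. t \<noteq> 0 \<and> \<bar>t\<bar> < \<tau> \<longrightarrow> conjugate f (u + t *\<^sub>R d) = ereal (\<phi> t)
      \<and> F + t * (x \<bullet> d) \<le> \<phi> t \<and> \<phi> t \<le> F + t * (x \<bullet> d) + \<bar>t\<bar> * e" if e: "e > 0" for e
  proof -
    obtain \<tau>1 where 1: "\<tau>1 > 0"
      "\<And>t. 0 < t \<Longrightarrow> t < \<tau>1 \<Longrightarrow> conjugate f (u + t *\<^sub>R d) \<le> ereal (F + t * (x \<bullet> d + e))"
      using upper[OF e, of d] by blast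
    obtain \<tau>2 where 2: "\<tau>2 > 0"
      "\<And>t. 0 < t \<Longrightarrow> t < \<tau>2 \<Longrightarrow> conjugate f (u + t *\<^sub>R (- d)) \<le> ereal (F + t * (x \<bullet> (- d) + e))"
      using upper[OF e, of "- d"] by blast
    have "conjugate f (u + t *\<^sub>R d) = ereal (\<phi> t)
      \<and> F + t * (x \<bullet> d) \<le> \<phi> t \<and> \<phi> t \<le> F + t * (x \<bullet> d) + \<bar>t\<bar> * e"
      if t: "t \<noteq> 0" "\<bar>t\<bar> < min \<tau>1 \<tau>2" for t
    proof -
      have "conjugate f (u + t *\<^sub>R d) \<le> ereal (F + t * (x \<bullet> d) + \<bar>t\<bar> * e)"
        using 1(2)[of t] 2(2)[of "- t"] t by (cases "t > 0") (auto simp: algebra_simps)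
      with lower[of t] show ?thesis
        by (cases "conjugate f (u + t *\<^sub>R d)") (auto simp: \<phi>_def)
    qed
    then show ?thesis using 1(1) 2(1) by (intro exI[of _ "min \<tau>1 \<tau>2"]) simp
  qed
  have "((\<lambda>t. (\<phi> t - F) / t) \<longlongrightarrow> x \<bullet> d) (at 0)"
  proof (rule LIM_I)
    fix e :: real assume "e > 0"
    then obtain \<tau> where \<tau>: "\<tau> > 0"
      "\<And>t. t \<noteq> 0 \<and> \<bar>t\<bar> < \<tau> \<Longrightarrow> F + t * (x \<bullet> d) \<le> \<phi> t \<and> \<phi> t \<le> F + t * (x \<bullet> d) + \<bar>t\<bar> * (e / 2)"
      using bound[of "e / 2"] by auto
    have "norm ((\<phi> t - F) / t - x \<bullet> d) < e" if t: "t \<noteq> 0 \<and> norm (t - 0) < \<tau>" for t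
    proof -
      have "(\<phi> t - F) / t - x \<bullet> d = (\<phi> t - F - t * (x \<bullet> d)) / t"
        using t by (simp add: field_simps)
      moreover have "\<bar>\<phi> t - F - t * (x \<bullet> d)\<bar> \<le> \<bar>t\<bar> * (e / 2)" using \<tau>(2)[of t] t by auto
      moreover have "\<bar>t\<bar> * (e / 2) < \<bar>t\<bar> * e" using t \<open>e > 0\<close> by simp
      ultimately show ?thesis using t by (simp add: abs_divide field_simps)
    qed
    then show "\<exists>s>0. \<forall>t. t \<noteq> 0 \<and> norm (t - 0) < s \<longrightarrow> norm ((\<phi> t - F) / t - x \<bullet> d) < e"
      using \<tau>(1) by blast
  qed
  then have "((\<lambda>t. ereal ((\<phi> t - F) / t)) \<longlongrightarrow> ereal (x \<bullet> d)) (at 0)" by simp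
  moreover have "eventually (\<lambda>t. ereal ((\<phi> t - F) / t)
      = (conjugate f (u + t *\<^sub>R d) - conjugate f u) / ereal t) (at 0)"
  proof -
    obtain \<tau> where "\<tau> > 0" "\<And>t. t \<noteq> 0 \<and> \<bar>t\<bar> < \<tau> \<Longrightarrow> conjugate f (u + t *\<^sub>R d) = ereal (\<phi> t)"
      using bound[of 1] by auto
    then show ?thesis
      by (auto simp: eventually_at dist_real_def F intro!: exI[of _ \<tau>])
  qed
  ultimately show "((\<lambda>t. (conjugate f (u + t *\<^sub>R d) - conjugate f u) / ereal t) \<longlongrightarrow> ereal (x \<bullet> d)) (at 0)"
    by (rule Lim_transform_eventually)
qed

section \<open>Legendre functions and the bijection of gradients\<close>

lemma legendre_inverse_subdiff_unique:
  assumes f: "f \<in> Gamma0" and "legendre f" and ux: "u \<in> subdiff f x" and uy: "u \<in> subdiff f y"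
  shows "x = y"
proof (rule ccontr)
  assume "x \<noteq> y"
  obtain r where r: "f x = ereal r" using subdiff_finite[OF f ux] by blast
  obtain s where s: "f y = ereal s" using subdiff_finite[OF f uy] by blast
  define F where "F = x \<bullet> u - r"
  have Fx: "conjugate f u = ereal F" unfolding F_def by (rule conjugate_eq_subdiff[OF f ux r])
  then have Fs: "F = y \<bullet> u - s" using conjugate_eq_subdiff[OF f uy s] by simp
  \<comment> \<open>Two points sharing the subgradient \<open>u\<close> force \<open>f\<close> to be
    affine on their segment, with \<open>u\<close> a subgradient throughout. The segment thus lies
    in the domain of \<open>subdiff f\<close>, and strict convexity fails at its midpoint.\<close>
  have seg: "f z \<le> ereal (z \<bullet> u - F) \<and> u \<in> subdiff f z" if z: "z \<in> closed_segment x y" for z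
  proof -
    obtain t where t: "0 \<le> t" "t \<le> 1" "z = (1 - t) *\<^sub>R x + t *\<^sub>R y"
      using z by (auto simp: closed_segment_def)
    have "f z \<le> ereal ((1 - t) * r + t * s)"
      unfolding t(3) using t by (intro Gamma0_convex_ineq f) (auto simp: r s)
    also have "(1 - t) * r + t * s = z \<bullet> u - F"
    proof -
      have "r = x \<bullet> u - F" "s = y \<bullet> u - F" using Fs by (simp_all add: F_def)
      then show ?thesis by (simp only: t(3) inner_add_left inner_scaleR_left) (simp add: algebra_simps)
    qed
    finally have "f z \<le> ereal (z \<bullet> u - F)" .
    then show ?thesis using subdiffI_conjugate[OF f, of u F z] Fx by simp
  qed
  have "closed_segment x y \<subseteq> op_dom (subdiff f)" using seg by (auto simp: op_dom_def)
  then have "strictly_convex_on (closed_segment x y) f"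
    using assms(2) by (simp add: legendre_def essentially_strictly_convex_def convex_closed_segment)
  then have "f ((1 - 1/2) *\<^sub>R x + (1/2) *\<^sub>R y) < ereal (1 - 1/2) * f x + ereal (1/2) * f y"
    using \<open>x \<noteq> y\<close> unfolding strictly_convex_on_def
    by (elim ballE[of _ _ x] ballE[of _ _ y] allE[of _ "1/2"]) auto
  then have "f ((1/2) *\<^sub>R x + (1/2) *\<^sub>R y) < ereal ((r + s) / 2)"
    by (simp add: r s add_divide_distrib)
  moreover have "ereal (((1/2) *\<^sub>R x + (1/2) *\<^sub>R y) \<bullet> u - F) \<le> f ((1/2) *\<^sub>R x + (1/2) *\<^sub>R y)"
    using Fx by (intro Fenchel_Young[OF f]) simp
  ultimately have "ereal (((1/2) *\<^sub>R x + (1/2) *\<^sub>R y) \<bullet> u - F) < ereal ((r + s) / 2)"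
    by (rule le_less_trans[rotated])
  moreover have "((1/2) *\<^sub>R x + (1/2) *\<^sub>R y) \<bullet> u - F = (r + s) / 2"
    using Fs by (simp add: F_def inner_add_left field_simps)
  ultimately show False by simp
qed

lemma legendre_gradient_subdiff:
  assumes f: "f \<in> Gamma0" and leg: "legendre f" and x: "x \<in> interior (edom f)"
  shows "subdiff f x = {gradient f x}"
proof -
  have "subdiff f x \<noteq> {}"
    using leg x by (auto simp: legendre_def essentially_smooth_def op_dom_def)
  moreover obtain g where g: "has_gateaux_gradient f g x"
    using leg x unfolding legendre_def essentially_smooth_def by blast
  ultimately show ?thesis
    using subgradient_eq_gateaux_gradient[OF f _ g] gradient_eqI[OF g] by auto
qed

text \<open>Starting from a pair \<open>u \<in> subdiff f x\<close> treats both directions of the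
  bijection at once: \<open>legendre_gradient_inverse\<close> then only has to find such a pair for
  a given \<open>x\<close> or a given \<open>u\<close>.\<close>

lemma legendre_subdiff_conjugate:
  fixes f :: "'a::{real_inner, complete_space} \<Rightarrow> ereal"
  assumes f: "f \<in> Gamma0" and leg: "legendre f" and u: "u \<in> subdiff f x"
  shows "x \<in> interior (edom f)" "gradient f x = u"
    "u \<in> interior (edom (conjugate f))" "gradient (conjugate f) u = x"
proof -
  show x: "x \<in> interior (edom f)"
    using leg u by (auto simp: legendre_def essentially_smooth_def op_dom_def)
  then show "gradient f x = u" using legendre_gradient_subdiff[OF f leg x] u by simp
  have lb: "locally_bounded_at (op_inverse (subdiff f)) u"
    using leg u by (auto simp: legendre_def essentially_strictly_convex_def op_dom_def op_inverse_def)
  show int: "u \<in> interior (edom (conjugate f))"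
    by (rule subgradient_in_interior_conjugate_domain[OF f u lb])
  show "gradient (conjugate f) u = x"
    by (rule gradient_eqI[OF conjugate_has_gateaux_gradient[OF f int u _ lb]])
      (rule legendre_inverse_subdiff_unique[OF f leg _ u])
qed

lemma legendre_gradient_inverse:
  fixes f :: "'a::{real_inner, complete_space} \<Rightarrow> ereal"
  assumes f: "f \<in> Gamma0" and leg: "legendre f"
  shows "x \<in> interior (edom f) \<Longrightarrow> gradient f x \<in> interior (edom (conjugate f))"
    and "x \<in> interior (edom f) \<Longrightarrow> gradient (conjugate f) (gradient f x) = x"
    and "u \<in> interior (edom (conjugate f)) \<Longrightarrow> gradient (conjugate f) u \<in> interior (edom f)"
    and "u \<in> interior (edom (conjugate f)) \<Longrightarrow> gradient f (gradient (conjugate f) u) = u"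
proof -
  assume "x \<in> interior (edom f)"
  then have "gradient f x \<in> subdiff f x" using legendre_gradient_subdiff[OF f leg] by simp
  then show "gradient f x \<in> interior (edom (conjugate f))" "gradient (conjugate f) (gradient f x) = x"
    by (fact legendre_subdiff_conjugate(3,4)[OF f leg])+
next
  assume "u \<in> interior (edom (conjugate f))"
  then obtain y where "u \<in> subdiff f y" by (rule interior_conjugate_domain_subset_range[OF f])
  note y = legendre_subdiff_conjugate[OF f leg \<open>u \<in> subdiff f y\<close>]
  show "gradient (conjugate f) u \<in> interior (edom f)" "gradient f (gradient (conjugate f) u) = u"
    unfolding y(4) by (fact y(1), fact y(2))
qed

section \<open>Bregman distances and equidistant sets under conjugation\<close>

lemma bregman_conjugate:
  fixes f :: "'a::{real_inner, complete_space} \<Rightarrow> ereal"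
  assumes f: "f \<in> Gamma0" and leg: "legendre f"
    and x: "x \<in> interior (edom f)" and y: "y \<in> interior (edom f)"
  shows "bregman (conjugate f) (gradient f y) (gradient f x) = bregman f x y"
proof -
  have sx: "gradient f x \<in> subdiff f x" and sy: "gradient f y \<in> subdiff f y"
    using legendre_gradient_subdiff[OF f leg] x y by auto
  obtain r where r: "f x = ereal r" using subdiff_finite[OF f sx] by blast
  obtain s where s: "f y = ereal s" using subdiff_finite[OF f sy] by blast
  \<comment> \<open>By Fenchel-Young equality at both points, each side equals
    \<open>f x + conjugate f (gradient f y) - x \<bullet> gradient f y\<close>.\<close>
  show ?thesis
    using y legendre_gradient_inverse(1,2)[OF f leg x] r s
      conjugate_eq_subdiff[OF f sx r] conjugate_eq_subdiff[OF f sy s]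
    by (simp add: bregman_def inner_diff_right inner_commute)
qed

text \<open>Needed for the third identity, since \<open>CCps_R (conjugate f)\<close> is defined
  through the gradient of the biconjugate. Essential smoothness supplies the point with a
  subgradient that \<open>Fenchel_Moreau\<close> asks for.\<close>

lemma legendre_conjugate_conjugate:
  fixes f :: "'a::{real_inner, complete_space} \<Rightarrow> ereal"
  assumes f: "f \<in> Gamma0" and leg: "legendre f"
  shows "conjugate (conjugate f) = f"
proof -
  have "interior (edom f) \<noteq> {}" using leg by (simp add: legendre_def essentially_smooth_def)
  then obtain x where "x \<in> interior (edom f)" by blast
  then show ?thesis using Fenchel_Moreau[OF f] legendre_gradient_subdiff[OF f leg] by blast
qed

text \<open>The reversal of arguments in \<open>bregman_conjugate\<close> exchanges left and right
  equidistance. Interiority of \<open>x\<close> is assumed because \<open>E_L\<close> may also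
  contain boundary points of the domain, whereas \<open>E_R\<close> lies in the interior.\<close>

lemma E_L_iff_E_R_conjugate:
  fixes f :: "'a::{real_inner, complete_space} \<Rightarrow> ereal"
  assumes f: "f \<in> Gamma0" and leg: "legendre f"
    and S: "S \<subseteq> interior (edom f)" and x: "x \<in> interior (edom f)"
  shows "x \<in> E_L f S \<longleftrightarrow> gradient f x \<in> E_R (conjugate f) (gradient_image f S)"
proof -
  have "x \<in> edom f" using x interior_subset by blast
  moreover have "gradient_image f S = gradient f ` S" using S by (auto simp: gradient_image_def)
  moreover have "bregman (conjugate f) (gradient f k) (gradient f x) = bregman f x k" if "k \<in> S" for k
    using that S by (intro bregman_conjugate f leg x) auto
  ultimately show ?thesis
    using legendre_gradient_inverse(1)[OF f leg x] by (simp add: E_L_def E_R_def)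
qed

lemma E_R_iff_E_L_conjugate:
  fixes f :: "'a::{real_inner, complete_space} \<Rightarrow> ereal"
  assumes f: "f \<in> Gamma0" and leg: "legendre f"
    and S: "S \<subseteq> interior (edom f)" and x: "x \<in> interior (edom f)"
  shows "x \<in> E_R f S \<longleftrightarrow> gradient f x \<in> E_L (conjugate f) (gradient_image f S)"
proof -
  have "gradient f x \<in> edom (conjugate f)"
    using legendre_gradient_inverse(1)[OF f leg x] interior_subset by blast
  moreover have "gradient_image f S = gradient f ` S" using S by (auto simp: gradient_image_def)
  moreover have "bregman (conjugate f) (gradient f x) (gradient f k) = bregman f k x" if "k \<in> S" for k
    using that S by (intro bregman_conjugate f leg x) auto
  ultimately show ?thesis
    using x by (simp add: E_L_def E_R_def)
qed

text \<open>An image under the inverse bijection is a preimage under \<open>gradient f\<close>; this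
  turns every identity of the theorem into a membership condition on
  \<open>gradient f x\<close>.\<close>

lemma mem_gradient_image_conjugate_iff:
  fixes f :: "'a::{real_inner, complete_space} \<Rightarrow> ereal"
  assumes "f \<in> Gamma0" "legendre f"
  shows "x \<in> gradient_image (conjugate f) V \<longleftrightarrow> x \<in> interior (edom f) \<and> gradient f x \<in> V"
proof
  assume "x \<in> gradient_image (conjugate f) V"
  then show "x \<in> interior (edom f) \<and> gradient f x \<in> V"
    using legendre_gradient_inverse(3,4)[OF assms] by (auto simp: gradient_image_def)
next
  assume "x \<in> interior (edom f) \<and> gradient f x \<in> V"
  then show "x \<in> gradient_image (conjugate f) V"
    using legendre_gradient_inverse(1,2)[OF assms]
    unfolding gradient_image_def by (intro image_eqI[of _ _ "gradient f x"]) auto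
qed

lemma gradient_mem_gradient_image_iff:
  fixes f :: "'a::{real_inner, complete_space} \<Rightarrow> ereal"
  assumes "f \<in> Gamma0" "legendre f" "x \<in> interior (edom f)"
  shows "gradient f x \<in> gradient_image f C \<longleftrightarrow> x \<in> C"
  using assms legendre_gradient_inverse(2)[OF assms(1,2)]
  unfolding gradient_image_def by (metis (no_types, lifting) IntE IntI image_iff)

theorem theorem5p1:
  fixes f :: "'a::{real_inner, complete_space} \<Rightarrow> ereal"
    and q :: "nat \<Rightarrow> 'a" and m :: nat and S :: "'a set"
  assumes "f \<in> Gamma0" and "legendre f"
    and "m \<ge> 1" and "S = q ` {0..m}" and "S \<subseteq> interior (edom f)"
  shows "(E_L f S \<inter> interior (edom f)
            = gradient_image (conjugate f) (E_R (conjugate f) (gradient_image f S)))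
       \<and> (E_R f S
            = gradient_image (conjugate f)
                (E_L (conjugate f) (gradient_image f S) \<inter> interior (edom (conjugate f))))
       \<and> (CCps_L f S \<inter> interior (edom f)
            = gradient_image (conjugate f) (CCps_R (conjugate f) (gradient_image f S)))
       \<and> (CC_R f S
            = affine hull S \<inter> gradient_image (conjugate f)
                (E_L (conjugate f) (gradient_image f S) \<inter> interior (edom (conjugate f))))
       \<and> (affine hull S \<inter> gradient_image (conjugate f)
                (E_L (conjugate f) (gradient_image f S) \<inter> interior (edom (conjugate f)))
            = gradient_image (conjugate f)
                (gradient_image f (affine hull S) \<inter> E_L (conjugate f) (gradient_image f S)))"
proof -
  note f = assms(1) and leg = assms(2) and S = assms(5)
  note simps = mem_gradient_image_conjugate_iff[OF f leg] CC_R_def CCps_L_def CCps_R_def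
    legendre_conjugate_conjugate[OF f leg]
  have E_R_int: "x \<in> E_R f S \<Longrightarrow> x \<in> interior (edom f)" for x by (simp add: E_R_def)
  \<comment> \<open>After unfolding, each identity is a propositional combination of membership
    facts about a single point; \<open>legendre_gradient_inverse(1)\<close> settles the
    intersections with the interior of the conjugate domain.\<close>
  show ?thesis
    using E_L_iff_E_R_conjugate[OF f leg S] E_R_iff_E_L_conjugate[OF f leg S] E_R_int
      legendre_gradient_inverse(1)[OF f leg] gradient_mem_gradient_image_iff[OF f leg]
    by (intro conjI set_eqI) (simp_all only: Int_iff simps, meson+)
qed

end
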